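(* For MLAPD on any rooted tree of depth $D$, the online algorithm \textsc{Waterfall} is $D$-competitive: on every instance, the total cost of its schedule is at most $D$ times the cost of an optimal schedule.
   Context: MLAPD: an instance is a rooted tree $\mathcal{T}$ with root $r$ and positive node costs $c(v)>0$, together with a set of requests $\rho=(v,a,d)$ issued at node $v$ with arrival time $a$ and deadline $d\ge a$ (deadlines distinct). A service $(S,t)$ is a subtree $S\ni r$ of $\mathcal{T}$ transmitted at time $t$, costing $c(S)=\sum_{u\in S}c(u)$; it satisfies $(v,a,d)$ if $v\in S$ and $a\le t\le d$. A feasible schedule satisfies every request; its cost is the sum of its service costs. Online: requests are revealed at arrival; the tree is known. Depth $D$: maximum number of nodes on a root-to-leaf path. $c$-competitive: cost at most $c$ times optimal on every instance. $\mathcal{T}_v$ is the subtree rooted at $v$. A request is pending at time $t$ if it has arrived by $t$ and was not satisfied by earlier transmissions. For a pending request $\rho$ in $\mathcal{T}_v$, $P(v\to\rho)$ is the node set of the path from $v$ to the node of $\rho$, $P_\rho=P(r\to\rho)$, and for a node set $S$, $P(v\to\rho\mid S)=P(v\to\rho)\setminus S$. \textsc{Waterfall}: every node $u$ carries a price $p(u)$, initialized to $c(u)$; write $p(X)=\sum_{u\in X}p(u)$. When a pending request $\rho$ reaches its deadline $t=d_\rho$: set $S=P_\rho$ and $p(v)=c(v)$ for $v\in P_\rho$; put the nodes of $P_\rho$ into a FIFO queue $Q$; while $Q\ne\emptyset$, dequeue a node $v$, run the $v$-fall on $S$ and enqueue every node it returns; finally transmit $(S,t)$. The $v$-fall: set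 $A=\emptyset$ and budget $b=c(v)$; go through the pending requests $\gamma$ in $\mathcal{T}_v$ in increasing order of deadline; for each, let $P=P(v\to\gamma\mid S)$ with the current $S$; if $p(P)>b$, replace $p(u)$ by $p(u)(1-b/p(P))$ for every $u\in P$ and stop; otherwise add $P$ to $A$ and to $S$, set $b\gets b-p(P)$, and reset $p(u)=c(u)$ for all $u\in P$. The $v$-fall returns $A$. *)

theory Defs
  imports Complex_Main "HOL-Library.While_Combinator"
begin

definition rooted_tree :: "'v set \<Rightarrow> 'v \<Rightarrow> ('v \<Rightarrow> 'v) \<Rightarrow> bool" where
  "rooted_tree V r par \<longleftrightarrow> finite V \<and> r \<in> V \<and> par r = r \<and>
     (\<forall>v\<in>V. par v \<in> V \<and> (\<exists>n. (par ^^ n) v = r))"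

definition anc :: "('v \<Rightarrow> 'v) \<Rightarrow> 'v \<Rightarrow> 'v set" where
  "anc par v = {(par ^^ n) v | n. True}"

text \<open>Depth: maximum number of nodes on a root-to-node (equivalently root-to-leaf) path.\<close>
definition depth :: "'v set \<Rightarrow> ('v \<Rightarrow> 'v) \<Rightarrow> nat" where
  "depth V par = Max ((\<lambda>v. card (anc par v)) ` V)"

definition path_from :: "('v \<Rightarrow> 'v) \<Rightarrow> 'v \<Rightarrow> 'v \<Rightarrow> 'v set" where
  "path_from par v w = {u \<in> anc par w. v \<in> anc par u}"

definition rooted_subtree :: "'v set \<Rightarrow> 'v \<Rightarrow> ('v \<Rightarrow> 'v) \<Rightarrow> 'v set \<Rightarrow> bool" where
  "rooted_subtree V r par S \<longleftrightarrow> S \<subseteq> V \<and> r \<in> S \<and> (\<forall>u\<in>S. par u \<in> S)"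

type_synonym 'v req = "'v \<times> real \<times> real"

definition rnode :: "'v req \<Rightarrow> 'v" where "rnode \<rho> = fst \<rho>"
definition arr :: "'v req \<Rightarrow> real" where "arr \<rho> = fst (snd \<rho>)"
definition dl :: "'v req \<Rightarrow> real" where "dl \<rho> = snd (snd \<rho>)"

definition mlapd_instance ::
  "'v set \<Rightarrow> 'v \<Rightarrow> ('v \<Rightarrow> 'v) \<Rightarrow> ('v \<Rightarrow> real) \<Rightarrow> 'v req set \<Rightarrow> bool" where
  "mlapd_instance V r par c R \<longleftrightarrow> rooted_tree V r par \<and> (\<forall>v\<in>V. c v > 0) \<and> finite R \<and>
     (\<forall>\<rho>\<in>R. rnode \<rho> \<in> V \<and> arr \<rho> \<le> dl \<rho>) \<and> inj_on dl R"

definition satisfies :: "'v set \<times> real \<Rightarrow> 'v req \<Rightarrow> bool" where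
  "satisfies s \<rho> \<longleftrightarrow> rnode \<rho> \<in> fst s \<and> arr \<rho> \<le> snd s \<and> snd s \<le> dl \<rho>"

definition feasible :: "'v set \<Rightarrow> 'v \<Rightarrow> ('v \<Rightarrow> 'v) \<Rightarrow> 'v req set \<Rightarrow> ('v set \<times> real) list \<Rightarrow> bool" where
  "feasible V r par R sched \<longleftrightarrow> (\<forall>s\<in>set sched. rooted_subtree V r par (fst s)) \<and>
     (\<forall>\<rho>\<in>R. \<exists>s\<in>set sched. satisfies s \<rho>)"

definition sched_cost :: "('v \<Rightarrow> real) \<Rightarrow> ('v set \<times> real) list \<Rightarrow> real" where
  "sched_cost c sched = (\<Sum>s\<leftarrow>sched. sum c (fst s))"

text \<open>Pending at time t w.r.t. the transmissions made so far (all at earlier times).\<close>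
definition pending :: "'v req set \<Rightarrow> ('v set \<times> real) list \<Rightarrow> real \<Rightarrow> 'v req \<Rightarrow> bool" where
  "pending R sched t \<gamma> \<longleftrightarrow> \<gamma> \<in> R \<and> arr \<gamma> \<le> t \<and> \<not> (\<exists>s\<in>set sched. satisfies s \<gamma>)"

text \<open>List the requests of X in increasing order of deadline (deadlines are distinct).\<close>
definition by_deadline :: "'v req set \<Rightarrow> 'v req list" where
  "by_deadline X = map (\<lambda>d. THE \<gamma>. \<gamma> \<in> X \<and> dl \<gamma> = d) (sorted_list_of_set (dl ` X))"

fun fall_loop :: "('v \<Rightarrow> 'v) \<Rightarrow> ('v \<Rightarrow> real) \<Rightarrow> 'v \<Rightarrow> 'v req list \<Rightarrow>
    ('v \<Rightarrow> real) \<Rightarrow> 'v set \<Rightarrow> 'v set \<Rightarrow> real \<Rightarrow> ('v \<Rightarrow> real) \<times> 'v set \<times> 'v set" where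
  "fall_loop par c v [] p S A b = (p, S, A)"
| "fall_loop par c v (\<gamma> # \<gamma>s) p S A b =
     (let P = path_from par v (rnode \<gamma>) - S; pP = sum p P in
      if pP > b then ((\<lambda>u. if u \<in> P then p u * (1 - b / pP) else p u), S, A)
      else fall_loop par c v \<gamma>s (\<lambda>u. if u \<in> P then c u else p u) (S \<union> P) (A \<union> P) (b - pP))"

definition fall :: "('v \<Rightarrow> 'v) \<Rightarrow> ('v \<Rightarrow> real) \<Rightarrow> 'v req set \<Rightarrow> ('v set \<times> real) list \<Rightarrow> real \<Rightarrow>
    'v \<Rightarrow> ('v \<Rightarrow> real) \<Rightarrow> 'v set \<Rightarrow> ('v \<Rightarrow> real) \<times> 'v set \<times> 'v set" where
  "fall par c R sched t v p S =
     fall_loop par c v (by_deadline {\<gamma>. pending R sched t \<gamma> \<and> v \<in> anc par (rnode \<gamma>)}) p S {} (c v)"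

text \<open>The FIFO queue loop. lin fixes the order in which a set of nodes is enqueued.\<close>
definition queue_loop :: "('v \<Rightarrow> 'v) \<Rightarrow> ('v \<Rightarrow> real) \<Rightarrow> 'v req set \<Rightarrow> ('v set \<Rightarrow> 'v list) \<Rightarrow>
    ('v set \<times> real) list \<Rightarrow> real \<Rightarrow> 'v list \<times> ('v \<Rightarrow> real) \<times> 'v set \<Rightarrow> 'v list \<times> ('v \<Rightarrow> real) \<times> 'v set" where
  "queue_loop par c R lin sched t st =
     the (while_option (\<lambda>(Q, p, S). Q \<noteq> [])
       (\<lambda>(Q, p, S). case fall par c R sched t (hd Q) p S of
                     (p', S', A) \<Rightarrow> (tl Q @ lin A, p', S')) st)"

definition wf_event :: "('v \<Rightarrow> 'v) \<Rightarrow> ('v \<Rightarrow> real) \<Rightarrow> 'v req set \<Rightarrow> ('v set \<Rightarrow> 'v list) \<Rightarrow>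
    real \<Rightarrow> ('v \<Rightarrow> real) \<times> ('v set \<times> real) list \<Rightarrow> ('v \<Rightarrow> real) \<times> ('v set \<times> real) list" where
  "wf_event par c R lin t st =
     (case st of (p, sched) \<Rightarrow>
       (let \<rho> = (THE \<rho>. \<rho> \<in> R \<and> dl \<rho> = t) in
        if pending R sched t \<rho> then
          (let P\<rho> = anc par (rnode \<rho>);
               p0 = (\<lambda>u. if u \<in> P\<rho> then c u else p u) in
           case queue_loop par c R lin sched t (lin P\<rho>, p0, P\<rho>) of
             (Q', p', S') \<Rightarrow> (p', sched @ [(S', t)]))
        else (p, sched)))"

definition waterfall :: "('v \<Rightarrow> 'v) \<Rightarrow> ('v \<Rightarrow> real) \<Rightarrow> 'v req set \<Rightarrow> ('v set \<Rightarrow> 'v list) \<Rightarrow>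
    ('v set \<times> real) list" where
  "waterfall par c R lin = snd (fold (wf_event par c R lin) (sorted_list_of_set (dl ` R)) (c, []))"

end

theory Submission
  imports Defs
begin

text \<open>Fix a feasible schedule \<open>opt\<close>. A node \<open>u\<close> is overdue at time \<open>t\<close> if some pending request
  below \<open>u\<close> expires before \<open>opt\<close> serves \<open>u\<close> again. A transmitted node that remains overdue has
  invested its whole budget into overdue descendants and charges its cost down to them; a
  transmitted node that was not overdue was paid for by investments of ancestors that did not
  remain overdue, and charges its cost up to them. A transmission that ends the overdue status
  of a node at level \<open>l\<close> thus collects at most \<open>l - 1\<close> times its cost from above and \<open>D - l\<close> times
  its cost from below, and between two such transmissions \<open>opt\<close> serves the node. The
  potential below carries out both chargings at once.\<close>

section \<open>Ancestor sets under iteration of the parent map\<close>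

lemma anc_refl [simp]: "v \<in> anc par v"
  unfolding anc_def by (rule CollectI, rule exI[of _ 0]) simp

lemma anc_trans:
  assumes "u \<in> anc par v" "v \<in> anc par w"
  shows "u \<in> anc par w"
proof -
  from assms obtain m n where "u = (par ^^ m) v" "v = (par ^^ n) w"
    unfolding anc_def by blast
  then have "u = (par ^^ (m + n)) w" by (simp add: funpow_add)
  then show ?thesis unfolding anc_def by blast
qed

lemma anc_subset: "u \<in> anc par v \<Longrightarrow> anc par u \<subseteq> anc par v"
  using anc_trans by fast

lemma par_in_anc [simp]: "par v \<in> anc par v"
  unfolding anc_def by (rule CollectI, rule exI[of _ 1]) simp

lemma anc_par:
  assumes "v \<in> anc par u" "v \<noteq> u"
  shows "v \<in> anc par (par u)"
proof -
  obtain n where n: "v = (par ^^ n) u" using assms(1) unfolding anc_def by blast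
  with assms(2) obtain m where "n = Suc m" by (cases n) auto
  then have "v = (par ^^ m) (par u)" using n by (simp add: funpow_swap1)
  then show ?thesis unfolding anc_def by blast
qed

lemma anc_subset_closed:
  assumes "\<And>u. u \<in> S \<Longrightarrow> par u \<in> S" "v \<in> S"
  shows "anc par v \<subseteq> S"
proof -
  have "(par ^^ n) v \<in> S" for n by (induction n) (auto simp: assms)
  then show ?thesis unfolding anc_def by blast
qed

section \<open>Deadline order, per-node cost and counting\<close>

lemma by_deadline_props:
  assumes "finite X" "inj_on dl X"
  shows set_by_deadline: "set (by_deadline X) = X"
    and sorted_by_deadline: "sorted_wrt (\<lambda>x y. dl x \<le> dl y) (by_deadline X)"
proof -
  \<comment> \<open>Distinct deadlines make the request recoverable from its deadline.\<close>
  have the: "(THE \<gamma>'. \<gamma>' \<in> X \<and> dl \<gamma>' = dl \<gamma>) = \<gamma>" if "\<gamma> \<in> X" for \<gamma>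
    using that assms(2) by (intro the_equality) (auto dest: inj_onD)
  show "set (by_deadline X) = X"
    using assms(1) by (auto simp: by_deadline_def the image_image)
  have "map dl (by_deadline X) = sorted_list_of_set (dl ` X)"
    unfolding by_deadline_def map_map
    by (rule map_idI) (use assms(1) in \<open>auto simp: the\<close>)
  then have "sorted (map dl (by_deadline X))" by simp
  then show "sorted_wrt (\<lambda>x y. dl x \<le> dl y) (by_deadline X)"
    by (simp add: sorted_map)
qed

text \<open>Exchanging the order of summation brings the optimal cost into the per-node form in
  which \<open>potential\<close> credits it.\<close>

lemma sched_cost_by_node:
  assumes "finite V" "\<forall>s\<in>set sched. fst s \<subseteq> V"
  shows "sched_cost c sched = (\<Sum>u\<in>V. c u * real (length (filter (\<lambda>s. u \<in> fst s) sched)))"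
  using assms(2)
proof (induction sched)
  case Nil
  then show ?case by (simp add: sched_cost_def)
next
  case (Cons s sched)
  have "sum c (fst s) = (\<Sum>u\<in>V. c u * of_bool (u \<in> fst s))"
    using Cons.prems assms(1) by (intro sum.mono_neutral_cong_left) auto
  moreover have "(\<Sum>u\<in>V. c u * real (length (filter (\<lambda>s. u \<in> fst s) (s # sched)))) =
      (\<Sum>u\<in>V. c u * of_bool (u \<in> fst s) + c u * real (length (filter (\<lambda>s. u \<in> fst s) sched)))"
    by (intro sum.cong) (auto simp: algebra_simps)
  ultimately show ?case
    using Cons by (simp add: sched_cost_def sum.distrib)
qed

lemma length_filter_mono:
  "(\<And>y. P y \<Longrightarrow> Q y) \<Longrightarrow> length (filter P xs) \<le> length (filter Q xs)"
  by (induction xs) (auto intro: le_SucI)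

lemma length_filter_strict_mono:
  assumes "x \<in> set xs" "Q x" "\<not> P x" "\<And>y. P y \<Longrightarrow> Q y"
  shows "length (filter P xs) < length (filter Q xs)"
proof -
  have "length (filter P xs) = length (filter P (filter Q xs))"
    unfolding filter_filter by (intro arg_cong[where f = length] filter_cong) (auto simp: assms(4))
  also have "\<dots> < length (filter Q xs)"
    by (rule length_filter_less[of x]) (use assms in auto)
  finally show ?thesis .
qed

section \<open>Tree structure, levels and depth of the instance\<close>

locale waterfall_run =
  fixes V :: "'v set" and r :: 'v and par :: "'v \<Rightarrow> 'v" and c :: "'v \<Rightarrow> real"
    and R :: "'v req set" and lin :: "'v set \<Rightarrow> 'v list"
    and opt :: "('v set \<times> real) list"
  assumes inst: "mlapd_instance V r par c R"
    and lin: "\<forall>X. X \<subseteq> V \<longrightarrow> distinct (lin X) \<and> set (lin X) = X"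
    and feas: "feasible V r par R opt"
begin

abbreviation "D \<equiv> real (depth V par)"
abbreviation "level u \<equiv> real (card (anc par u))"

lemma finite_V: "finite V" and par_root: "par r = r"
  and par_in_V: "\<And>v. v \<in> V \<Longrightarrow> par v \<in> V"
  and reaches_root: "\<And>v. v \<in> V \<Longrightarrow> \<exists>n. (par ^^ n) v = r"
  and cost_pos: "\<And>v. v \<in> V \<Longrightarrow> c v > 0"
  and finite_R: "finite R" and rnode_in_V: "\<And>\<rho>. \<rho> \<in> R \<Longrightarrow> rnode \<rho> \<in> V"
  and arr_le_dl: "\<And>\<rho>. \<rho> \<in> R \<Longrightarrow> arr \<rho> \<le> dl \<rho>" and inj_dl: "inj_on dl R"
  using inst unfolding mlapd_instance_def rooted_tree_def by auto

lemma anc_in_V: "v \<in> V \<Longrightarrow> anc par v \<subseteq> V"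
  by (rule anc_subset_closed) (rule par_in_V)

lemma root_in_anc: "v \<in> V \<Longrightarrow> r \<in> anc par v"
  using reaches_root[of v] unfolding anc_def by auto

lemma rooted_subtree_anc: "v \<in> V \<Longrightarrow> rooted_subtree V r par (anc par v)"
  unfolding rooted_subtree_def
  using anc_in_V root_in_anc by (meson anc_trans par_in_anc)

lemma rooted_subtree_anc_subset:
  "rooted_subtree V r par S \<Longrightarrow> v \<in> S \<Longrightarrow> anc par v \<subseteq> S"
  unfolding rooted_subtree_def by (blast intro: anc_subset_closed[THEN subsetD])

text \<open>A cycle of the parent map can be traversed forever, yet iteration from \<open>u\<close>
  gets absorbed in the fixed point \<open>r\<close>; so a cycle of positive length consists of
  \<open>r\<close> alone.\<close>

lemma anc_antisym:
  assumes "u \<in> V" "v \<in> anc par u" "u \<in> anc par v"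
  shows "u = v"
proof -
  obtain m n where m: "v = (par ^^ m) u" and n: "u = (par ^^ n) v"
    using assms unfolding anc_def by blast
  have fix_root: "(par ^^ k) r = r" for k by (induction k) (auto simp: par_root)
  have period: "(par ^^ (n + m)) u = u" using m n by (simp add: funpow_add)
  have periods: "(par ^^ (k * (n + m))) u = u" for k
    by (induction k) (simp_all add: funpow_add[of "n + m"] period del: funpow_add)
  obtain l where l: "(par ^^ l) u = r" using reaches_root[OF assms(1)] by blast
  show ?thesis
  proof (cases "n + m = 0")
    case False
    \<comment> \<open>Going \<open>l\<close> times around the cycle takes at least \<open>l\<close>
      steps, so \<open>r\<close> has been reached on the way.\<close>
    then have "l * 1 \<le> l * (n + m)" by (intro mult_le_mono2) linarith
    then have "l \<le> l * (n + m)" by simp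
    then have "(par ^^ (l * (n + m))) u = (par ^^ (l * (n + m) - l)) ((par ^^ l) u)"
      by (metis comp_apply funpow_add le_add_diff_inverse2)
    then have "u = r" using periods[of l] l fix_root by simp
    then show ?thesis using m fix_root by simp
  qed (use m in simp)
qed

lemma level_less:
  assumes "u \<in> V" "v \<in> anc par u" "u \<noteq> v"
  shows "level v + 1 \<le> level u"
proof -
  have "u \<notin> anc par v" using anc_antisym assms by blast
  then have "anc par v \<subset> anc par u" using anc_subset[OF assms(2)] by auto
  then have "card (anc par v) < card (anc par u)"
    using anc_in_V[OF assms(1)] finite_V by (intro psubset_card_mono) (auto intro: finite_subset)
  then show ?thesis by simp
qed

lemma level_le_depth: "u \<in> V \<Longrightarrow> level u \<le> D"
  unfolding depth_def using finite_V by simp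

lemma level_ge_1: "u \<in> V \<Longrightarrow> 1 \<le> level u"
  using anc_in_V[of u] finite_V anc_refl[of u par]
  by (metis One_nat_def Suc_leI card_gt_0_iff empty_iff finite_subset of_nat_1 of_nat_le_iff)

section \<open>Overdue nodes and their weights\<close>

definition overdue :: "real \<Rightarrow> 'v req set \<Rightarrow> 'v \<Rightarrow> bool" where
  "overdue t X u \<longleftrightarrow> (\<exists>\<gamma>\<in>X. u \<in> anc par (rnode \<gamma>) \<and>
     \<not> (\<exists>s\<in>set opt. u \<in> fst s \<and> t < snd s \<and> snd s \<le> dl \<gamma>))"

text \<open>The gain of \<open>potential\<close> per unit by which the price of \<open>u\<close>
  drops: \<open>level u - 1\<close> while \<open>u\<close> is overdue, negative otherwise.\<close>

definition weight :: "real \<Rightarrow> 'v req set \<Rightarrow> 'v \<Rightarrow> real" where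
  "weight t X u = level u - 1 - D + D * of_bool (overdue t X u)"

lemma overdue_mono: "overdue t X u \<Longrightarrow> X \<subseteq> Y \<Longrightarrow> overdue t Y u"
  unfolding overdue_def by blast

text \<open>An optimal service of \<open>u\<close> in time for \<open>\<gamma>\<close> would also
  contain the ancestor \<open>v\<close> and meet every deadline in \<open>Y\<close>, so
  \<open>v\<close> would not be overdue. This is what processing requests by deadline
  achieves.\<close>

lemma overdue_on_path:
  assumes "overdue t Y v" "\<forall>\<gamma>'\<in>Y. dl \<gamma> \<le> dl \<gamma>'" "\<gamma> \<in> X" "u \<in> path_from par v (rnode \<gamma>)"
  shows "overdue t X u"
proof -
  obtain \<gamma>' where \<gamma>': "\<gamma>' \<in> Y" "\<not> (\<exists>s\<in>set opt. v \<in> fst s \<and> t < snd s \<and> snd s \<le> dl \<gamma>')"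
    using assms(1) unfolding overdue_def by blast
  have "\<not> (\<exists>s\<in>set opt. u \<in> fst s \<and> t < snd s \<and> snd s \<le> dl \<gamma>)"
  proof
    assume "\<exists>s\<in>set opt. u \<in> fst s \<and> t < snd s \<and> snd s \<le> dl \<gamma>"
    then obtain s where s: "s \<in> set opt" "u \<in> fst s" "t < snd s" "snd s \<le> dl \<gamma>" by blast
    then have "rooted_subtree V r par (fst s)" using feas unfolding feasible_def by blast
    then have "v \<in> fst s"
      using rooted_subtree_anc_subset s(2) assms(4) unfolding path_from_def by blast
    moreover have "snd s \<le> dl \<gamma>'" using s(4) assms(2) \<gamma>'(1) by force
    ultimately show False using \<gamma>'(2) s by blast
  qed
  then show ?thesis using assms(3,4) unfolding overdue_def path_from_def by blast
qed

text \<open>A strict descendant lies at least one level deeper, which absorbs the \<open>- 1\<close>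
  in \<open>weight\<close>, and it inherits the overdue status of \<open>v\<close>.\<close>

lemma weight_on_path:
  assumes "\<gamma> \<in> X" "X \<subseteq> R" "u \<in> path_from par v (rnode \<gamma>)" "u \<noteq> v"
    and "\<forall>\<gamma>'\<in>Y. dl \<gamma> \<le> dl \<gamma>'"
  shows "level v - D + D * of_bool (overdue t Y v) \<le> weight t X u"
proof -
  have "u \<in> V" "v \<in> anc par u"
    using assms rnode_in_V anc_in_V unfolding path_from_def by blast+
  then have "level v + 1 \<le> level u" using assms(4) level_less by blast
  moreover have "overdue t Y v \<longrightarrow> overdue t X u" using overdue_on_path assms by blast
  ultimately show ?thesis unfolding weight_def by (auto simp: of_bool_def)
qed

lemma rooted_subtree_add_path:
  assumes "rooted_subtree V r par S" "v \<in> S" "w \<in> V"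
  shows "rooted_subtree V r par (S \<union> (path_from par v w - S))"
proof -
  have "par u \<in> S \<union> path_from par v w" if "u \<in> path_from par v w" for u
  proof (cases "u = v")
    case True
    then show ?thesis using assms unfolding rooted_subtree_def by blast
  next
    case False
    then have "v \<in> anc par (par u)" using that anc_par unfolding path_from_def by fast
    moreover have "par u \<in> anc par w"
      using that anc_trans[OF par_in_anc] unfolding path_from_def by fast
    ultimately show ?thesis unfolding path_from_def by blast
  qed
  moreover have "path_from par v w \<subseteq> V"
    using anc_in_V[OF assms(3)] unfolding path_from_def by blast
  ultimately show ?thesis using assms(1) unfolding rooted_subtree_def by blast
qed

section \<open>Investments of a single fall\<close>

definition price_inv :: "('v \<Rightarrow> real) \<Rightarrow> bool" where
  "price_inv p \<longleftrightarrow> (\<forall>u\<in>V. 0 < p u \<and> p u \<le> c u)"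

text \<open>A fall of budget \<open>b\<close> invests it into strict descendants of \<open>v\<close>. If \<open>v\<close> stays overdue, the
  whole budget is spent, and only on overdue nodes.\<close>
lemma fall_loop_investment:
  assumes "fall_loop par c v \<gamma>s p S A b = (p', S', A')"
    and "set \<gamma>s \<subseteq> X" "X \<subseteq> R" "sorted_wrt (\<lambda>x y. dl x \<le> dl y) \<gamma>s"
    and "\<forall>\<gamma>\<in>set \<gamma>s. v \<in> anc par (rnode \<gamma>)"
    and "0 \<le> b" "v \<in> S" "rooted_subtree V r par S" "\<forall>u\<in>S. p u = c u" "price_inv p"
  shows "S \<subseteq> S' \<and> rooted_subtree V r par S' \<and> A' = A \<union> (S' - S) \<and> (\<forall>u\<in>S'. p' u = c u) \<and>
    price_inv p' \<and>
    b * (level v - D + D * of_bool (overdue t {\<gamma> \<in> set \<gamma>s. rnode \<gamma> \<notin> S'} v))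
      \<le> (\<Sum>u\<in>V. weight t X u * (p u - p' u)) + (\<Sum>u\<in>S' - S. weight t X u * c u)"
  using assms
proof (induction \<gamma>s arbitrary: p S A b)
  case Nil
  have "v \<in> V" using Nil.prems unfolding rooted_subtree_def by blast
  \<comment> \<open>With no request left \<open>v\<close> is not overdue, and then unspent budget is
    harmless because its coefficient is not positive.\<close>
  then have "b * (level v - D) \<le> 0"
    using level_le_depth \<open>0 \<le> b\<close> by (intro mult_nonneg_nonpos) auto
  then show ?case using Nil by (auto simp: overdue_def)
next
  case (Cons \<gamma> \<gamma>s)
  define P where "P = path_from par v (rnode \<gamma>) - S"
  have \<gamma>R: "\<gamma> \<in> R" and \<gamma>X: "\<gamma> \<in> X" using Cons.prems by auto
  have sub: "rooted_subtree V r par (S \<union> P)"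
    unfolding P_def using rooted_subtree_add_path Cons.prems rnode_in_V[OF \<gamma>R] by blast
  then have PV: "P \<subseteq> V" unfolding rooted_subtree_def by blast
  have finP: "finite P" using PV finite_V finite_subset by blast
  have pos: "p u > 0" if "u \<in> P" for u
    using that PV Cons.prems unfolding price_inv_def by blast
  \<comment> \<open>\<open>Y\<close> will be the set of requests that the fall leaves unserved;
    \<open>\<gamma>\<close> heads the sorted list, so no deadline in \<open>Y\<close> is
    earlier.\<close>
  have invest: "(level v - D + D * of_bool (overdue t Y v)) * sum p P \<le> (\<Sum>u\<in>P. weight t X u * p u)"
    if "Y \<subseteq> set (\<gamma> # \<gamma>s)" for Y
    unfolding sum_distrib_left
  proof (rule sum_mono, rule mult_right_mono)
    fix u assume u: "u \<in> P"
    have "\<forall>\<gamma>'\<in>Y. dl \<gamma> \<le> dl \<gamma>'" using that Cons.prems(4) by auto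
    moreover have "u \<noteq> v" using u Cons.prems(7) P_def by blast
    ultimately show "level v - D + D * of_bool (overdue t Y v) \<le> weight t X u"
      using weight_on_path[of \<gamma> X u v Y t] u \<gamma>X Cons.prems(3) P_def by blast
    show "0 \<le> p u" using pos[OF u] by simp
  qed
  show ?case
  proof (cases "sum p P > b")
    case True
    \<comment> \<open>All prices on the path drop by the same fraction \<open>q\<close>, chosen so
      that the drops add up to the whole remaining budget.\<close>
    define q where "q = b / sum p P"
    have q: "0 \<le> q" "q < 1" "b = q * sum p P" using True Cons.prems(6) by (auto simp: q_def)
    have eqs: "p' = (\<lambda>u. if u \<in> P then p u * (1 - q) else p u)" "S' = S" "A' = A"
      using Cons.prems(1) True by (auto simp: Let_def P_def q_def)
    let ?k = "level v - D + D * of_bool (overdue t {\<gamma>' \<in> set (\<gamma> # \<gamma>s). rnode \<gamma>' \<notin> S'} v)"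
    have "price_inv p'"
      unfolding price_inv_def
    proof
      fix u assume "u \<in> V"
      then have "0 < p u" "p u \<le> c u" using Cons.prems(10) unfolding price_inv_def by auto
      moreover have "p u * (1 - q) \<le> c u"
        using q \<open>0 < p u\<close> \<open>p u \<le> c u\<close> mult_left_mono[of "1 - q" 1 "p u"] by linarith
      ultimately show "0 < p' u \<and> p' u \<le> c u" using q unfolding eqs by (cases "u \<in> P") auto
    qed
    moreover have "\<forall>u\<in>S'. p' u = c u" using Cons.prems(9) unfolding eqs P_def by auto
    moreover have "b * ?k \<le> (\<Sum>u\<in>V. weight t X u * (p u - p' u))"
    proof -
      have "?k * sum p P \<le> (\<Sum>u\<in>P. weight t X u * p u)" by (rule invest) blast
      then have "q * (?k * sum p P) \<le> q * (\<Sum>u\<in>P. weight t X u * p u)"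
        using q(1) by (rule mult_left_mono)
      also have "\<dots> = (\<Sum>u\<in>P. weight t X u * (p u - p' u))"
        unfolding sum_distrib_left eqs by (intro sum.cong) (auto simp: algebra_simps)
      also have "\<dots> = (\<Sum>u\<in>V. weight t X u * (p u - p' u))"
        using PV finite_V by (intro sum.mono_neutral_left) (auto simp: eqs)
      finally show ?thesis using q(3) by (simp add: algebra_simps)
    qed
    ultimately show ?thesis using Cons.prems(8) by (simp add: eqs)
  next
    case False
    define p1 where "p1 = (\<lambda>u. if u \<in> P then c u else p u)"
    have run: "fall_loop par c v \<gamma>s p1 (S \<union> P) (A \<union> P) (b - sum p P) = (p', S', A')"
      using Cons.prems(1) False by (simp add: Let_def P_def p1_def)
    have p1: "price_inv p1" "\<forall>u\<in>S \<union> P. p1 u = c u"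
      using Cons.prems(9,10) cost_pos unfolding price_inv_def p1_def by auto
    have rest: "set \<gamma>s \<subseteq> X" "sorted_wrt (\<lambda>x y. dl x \<le> dl y) \<gamma>s"
        "\<forall>\<gamma>\<in>set \<gamma>s. v \<in> anc par (rnode \<gamma>)" "0 \<le> b - sum p P" "v \<in> S \<union> P"
      using Cons.prems False by auto
    have IH: "S \<union> P \<subseteq> S'" "rooted_subtree V r par S'"
        "A' = A \<union> P \<union> (S' - (S \<union> P))" "\<forall>u\<in>S'. p' u = c u" "price_inv p'"
      "(b - sum p P) * (level v - D + D * of_bool (overdue t {\<gamma>' \<in> set \<gamma>s. rnode \<gamma>' \<notin> S'} v))
      \<le> (\<Sum>u\<in>V. weight t X u * (p1 u - p' u)) + (\<Sum>u\<in>S' - (S \<union> P). weight t X u * c u)"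
      using Cons.IH[OF run rest(1) Cons.prems(3) rest(2-5) sub p1(2,1)] by blast+
    \<comment> \<open>\<open>\<gamma>\<close> is now served, so it cannot contribute to
      \<open>v\<close> staying overdue.\<close>
    have "rnode \<gamma> \<in> S \<union> P" using Cons.prems(5) unfolding P_def path_from_def by auto
    then have same: "{\<gamma>' \<in> set (\<gamma> # \<gamma>s). rnode \<gamma>' \<notin> S'} = {\<gamma>' \<in> set \<gamma>s. rnode \<gamma>' \<notin> S'}"
      using IH(1) by auto
    let ?k = "level v - D + D * of_bool (overdue t {\<gamma>' \<in> set \<gamma>s. rnode \<gamma>' \<notin> S'} v)"
    have "S' \<subseteq> V" using IH(2) unfolding rooted_subtree_def by blast
    then have finS': "finite S'" using finite_V finite_subset by blast
    have "S' - S = P \<union> (S' - (S \<union> P))" using IH(1) P_def by blast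
    then have split: "(\<Sum>u\<in>S' - S. weight t X u * c u) =
        (\<Sum>u\<in>P. weight t X u * c u) + (\<Sum>u\<in>S' - (S \<union> P). weight t X u * c u)"
      using sum.union_disjoint[of P "S' - (S \<union> P)"] finP finS' by auto
    have "(\<Sum>u\<in>V. weight t X u * (p u - p' u)) - (\<Sum>u\<in>V. weight t X u * (p1 u - p' u)) =
        (\<Sum>u\<in>V. weight t X u * (p u - p1 u))"
      unfolding sum_subtractf[symmetric] by (intro sum.cong) (auto simp: algebra_simps)
    also have "\<dots> = (\<Sum>u\<in>P. weight t X u * (p u - p1 u))"
      using PV finite_V by (intro sum.mono_neutral_right) (auto simp: p1_def)
    also have "\<dots> = (\<Sum>u\<in>P. weight t X u * p u) - (\<Sum>u\<in>P. weight t X u * c u)"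
      unfolding sum_subtractf[symmetric] by (intro sum.cong) (auto simp: p1_def algebra_simps)
    \<comment> \<open>Resetting a price from \<open>p u\<close> to \<open>c u\<close> loses
      \<open>c u - p u\<close>, and the transmitted node is credited \<open>c u\<close>; the net
      amount \<open>p u\<close> is the budget spent on \<open>u\<close>.\<close>
    finally have "(\<Sum>u\<in>V. weight t X u * (p u - p' u)) + (\<Sum>u\<in>S' - S. weight t X u * c u) =
        (\<Sum>u\<in>P. weight t X u * p u) + ((\<Sum>u\<in>V. weight t X u * (p1 u - p' u)) +
        (\<Sum>u\<in>S' - (S \<union> P). weight t X u * c u))" using split by simp
    moreover have "?k * sum p P \<le> (\<Sum>u\<in>P. weight t X u * p u)" by (rule invest) auto
    ultimately have "b * ?k \<le> (\<Sum>u\<in>V. weight t X u * (p u - p' u)) + (\<Sum>u\<in>S' - S. weight t X u * c u)"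
      using IH(6) by (simp add: algebra_simps)
    moreover have "S \<subseteq> S'" "A' = A \<union> (S' - S)" using IH(1,3) P_def by blast+
    ultimately show ?thesis unfolding same using IH(2,4,5) by blast
  qed
qed

section \<open>Falls and the queue within one transmission\<close>

definition pend :: "('v set \<times> real) list \<Rightarrow> real \<Rightarrow> 'v req set" where
  "pend sched t = {\<gamma>. pending R sched t \<gamma>}"

lemma pend_subset: "pend sched t \<subseteq> R"
  unfolding pend_def pending_def by blast

lemma fall_investment:
  assumes "fall par c R sched t v p S = (p', S', A)"
    and "v \<in> S" "rooted_subtree V r par S" "\<forall>u\<in>S. p u = c u" "price_inv p"
  shows "S \<subseteq> S' \<and> rooted_subtree V r par S' \<and> A = S' - S \<and> (\<forall>u\<in>S'. p' u = c u) \<and>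
    price_inv p' \<and>
    c v * (level v - D + D * of_bool (overdue t {\<gamma> \<in> pend sched t. rnode \<gamma> \<notin> S'} v))
      \<le> (\<Sum>u\<in>V. weight t (pend sched t) u * (p u - p' u)) + (\<Sum>u\<in>S' - S. weight t (pend sched t) u * c u)"
proof -
  let ?Y = "{\<gamma>. pending R sched t \<gamma> \<and> v \<in> anc par (rnode \<gamma>)}"
  have YR: "?Y \<subseteq> R" unfolding pending_def by blast
  have Y: "finite ?Y" "inj_on dl ?Y"
    using finite_subset[OF YR finite_R] inj_on_subset[OF inj_dl YR] by blast+
  \<comment> \<open>Requests outside the subtree of \<open>v\<close> cannot make \<open>v\<close>
    overdue.\<close>
  have eq: "overdue t {\<gamma> \<in> ?Y. rnode \<gamma> \<notin> S'} v = overdue t {\<gamma> \<in> pend sched t. rnode \<gamma> \<notin> S'} v"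
    unfolding overdue_def pend_def by blast
  have "v \<in> V" using assms unfolding rooted_subtree_def by blast
  then have "0 \<le> c v" using cost_pos by force
  have subX: "set (by_deadline ?Y) \<subseteq> pend sched t"
    unfolding set_by_deadline[OF Y] pend_def by blast
  have anc: "\<forall>\<gamma>\<in>set (by_deadline ?Y). v \<in> anc par (rnode \<gamma>)"
    unfolding set_by_deadline[OF Y] by blast
  show ?thesis
    using fall_loop_investment[OF assms(1)[unfolded fall_def] subX pend_subset
        sorted_by_deadline[OF Y] anc \<open>0 \<le> c v\<close> assms(2-5), of t]
    unfolding set_by_deadline[OF Y] eq by simp
qed

text \<open>Only the dequeued nodes \<open>S - set Q\<close> have invested their budgets. The
  expiring path \<open>P\<close> was bought by no fall, hence the sum over \<open>S - P\<close>;
  \<open>p0\<close> stands for the prices after the reset on \<open>P\<close>.\<close>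

definition queue_inv where
  "queue_inv sched t p0 P = (\<lambda>(Q, p, S). P \<subseteq> S \<and> rooted_subtree V r par S \<and> distinct Q \<and> set Q \<subseteq> S \<and>
     (\<forall>u\<in>S. p u = c u) \<and> price_inv p \<and>
     (\<Sum>v\<in>S - set Q. c v * (level v - D + D * of_bool (overdue t {\<gamma> \<in> pend sched t. rnode \<gamma> \<notin> S} v)))
       \<le> (\<Sum>u\<in>V. weight t (pend sched t) u * (p0 u - p u)) +
         (\<Sum>u\<in>S - P. weight t (pend sched t) u * c u))"

text \<open>A fall returns only nodes outside \<open>S\<close>, so no node is enqueued twice and
  each round adds exactly \<open>v\<close> to the dequeued nodes. The number of nodes not yet
  dequeued is thus a termination measure.\<close>

lemma queue_inv_step:
  assumes inv: "queue_inv sched t p0 P (v # Q, p, S)"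
    and fall: "fall par c R sched t v p S = (p', S', A)"
  shows "queue_inv sched t p0 P (Q @ lin A, p', S')"
    and "card (V - (S' - set (Q @ lin A))) < card (V - (S - set (v # Q)))"
proof -
  let ?X = "pend sched t"
  have pre: "P \<subseteq> S" "rooted_subtree V r par S" "distinct (v # Q)" "set (v # Q) \<subseteq> S"
      "\<forall>u\<in>S. p u = c u" "price_inv p"
    and sum: "(\<Sum>v\<in>S - set (v # Q). c v * (level v - D + D * of_bool (overdue t {\<gamma> \<in> ?X. rnode \<gamma> \<notin> S} v)))
       \<le> (\<Sum>u\<in>V. weight t ?X u * (p0 u - p u)) + (\<Sum>u\<in>S - P. weight t ?X u * c u)"
    using inv unfolding queue_inv_def by auto
  have "v \<in> S" using pre(4) by simp
  then have post: "S \<subseteq> S'" "rooted_subtree V r par S'" "A = S' - S" "\<forall>u\<in>S'. p' u = c u" "price_inv p'"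
    and step: "c v * (level v - D + D * of_bool (overdue t {\<gamma> \<in> ?X. rnode \<gamma> \<notin> S'} v))
      \<le> (\<Sum>u\<in>V. weight t ?X u * (p u - p' u)) + (\<Sum>u\<in>S' - S. weight t ?X u * c u)"
    using fall_investment[OF fall] pre by blast+
  have SV: "S' \<subseteq> V" using post(2) unfolding rooted_subtree_def by blast
  then have fin: "finite S'" using finite_V finite_subset by blast
  have "A \<subseteq> V" using SV post(3) by blast
  then have linA: "distinct (lin A)" "set (lin A) = A" using lin by auto
  let ?f = "\<lambda>S v. c v * (level v - D + D * of_bool (overdue t {\<gamma> \<in> ?X. rnode \<gamma> \<notin> S} v))"
  have don: "S' - set (Q @ lin A) = insert v (S - set (v # Q))"
    using linA post pre(3,4) by auto
  have "sum (?f S') (S' - set (Q @ lin A)) = ?f S' v + sum (?f S') (S - set (v # Q))"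
    unfolding don using fin post(1) by (subst sum.insert) (auto intro: finite_subset)
  \<comment> \<open>As the transmission grows, nodes handled earlier can only lose their overdue
    status, which lowers their coefficients.\<close>
  also have "sum (?f S') (S - set (v # Q)) \<le> sum (?f S) (S - set (v # Q))"
  proof (intro sum_mono mult_left_mono add_left_mono)
    fix u assume "u \<in> S - set (v # Q)"
    then show "0 \<le> c u" using cost_pos post(1) SV by force
    have "overdue t {\<gamma> \<in> ?X. rnode \<gamma> \<notin> S'} u \<Longrightarrow> overdue t {\<gamma> \<in> ?X. rnode \<gamma> \<notin> S} u"
      by (erule overdue_mono) (use post(1) in blast)
    then show "(of_bool (overdue t {\<gamma> \<in> ?X. rnode \<gamma> \<notin> S'} u) :: real)
        \<le> of_bool (overdue t {\<gamma> \<in> ?X. rnode \<gamma> \<notin> S} u)" by simp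
  qed simp
  finally have "sum (?f S') (S' - set (Q @ lin A)) \<le>
      (\<Sum>u\<in>V. weight t ?X u * (p u - p' u)) + (\<Sum>u\<in>S' - S. weight t ?X u * c u) +
      ((\<Sum>u\<in>V. weight t ?X u * (p0 u - p u)) + (\<Sum>u\<in>S - P. weight t ?X u * c u))"
    using sum step by linarith
  moreover have "(\<Sum>u\<in>V. weight t ?X u * (p u - p' u)) + (\<Sum>u\<in>V. weight t ?X u * (p0 u - p u)) =
      (\<Sum>u\<in>V. weight t ?X u * (p0 u - p' u))"
    unfolding sum.distrib[symmetric] by (intro sum.cong) (auto simp: algebra_simps)
  moreover have "(\<Sum>u\<in>S' - S. weight t ?X u * c u) + (\<Sum>u\<in>S - P. weight t ?X u * c u) =
      (\<Sum>u\<in>S' - P. weight t ?X u * c u)"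
  proof -
    have "S' - P = (S' - S) \<union> (S - P)" using post(1) pre(1) by blast
    then show ?thesis
      using fin finite_subset[OF post(1) fin] by (subst sum.union_disjoint[symmetric]) auto
  qed
  ultimately have "sum (?f S') (S' - set (Q @ lin A)) \<le>
      (\<Sum>u\<in>V. weight t ?X u * (p0 u - p' u)) + (\<Sum>u\<in>S' - P. weight t ?X u * c u)" by linarith
  then show "queue_inv sched t p0 P (Q @ lin A, p', S')"
    using pre post linA unfolding queue_inv_def by auto
  have "v \<in> V" using \<open>v \<in> S\<close> post(1) SV by blast
  then show "card (V - (S' - set (Q @ lin A))) < card (V - (S - set (v # Q)))"
    unfolding don using finite_V by (intro psubset_card_mono) auto
qed

lemma queue_loop_inv:
  assumes "queue_inv sched t p0 P st"
  shows "\<exists>p S. queue_loop par c R lin sched t st = ([], p, S) \<and> queue_inv sched t p0 P ([], p, S)"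
proof -
  define step where "step = (\<lambda>(Q, p, S). case fall par c R sched t (hd Q) p S of
                     (p', S', A) \<Rightarrow> (tl Q @ lin A, p', S'))"
  define more :: "'v list \<times> ('v \<Rightarrow> real) \<times> 'v set \<Rightarrow> bool" where "more = (\<lambda>(Q, p, S). Q \<noteq> [])"
  define f where "f = (\<lambda>(Q :: 'v list, p :: 'v \<Rightarrow> real, S). card (V - (S - set Q)))"
  have main: "queue_inv sched t p0 P (step st) \<and> f (step st) < f st"
    if inv: "queue_inv sched t p0 P st" and ne: "more st" for st
  proof -
    obtain Q p S where st: "st = (Q, p, S)" by (cases st)
    with ne obtain v Q' where Q: "Q = v # Q'" unfolding more_def by (cases Q) auto
    obtain p' S' A where fall: "fall par c R sched t v p S = (p', S', A)"
      by (cases "fall par c R sched t v p S")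
    show ?thesis using queue_inv_step[OF inv[unfolded st Q] fall]
      by (simp add: st Q step_def f_def fall)
  qed
  \<comment> \<open>The decreasing measure makes \<open>while_option\<close> return
    \<open>Some\<close>, so \<open>the\<close> in \<open>queue_loop\<close> yields a genuine final
    state.\<close>
  obtain st' where run: "while_option more step st = Some st'"
    using measure_while_option_Some[of "queue_inv sched t p0 P" more step f] main assms by blast
  have "queue_inv sched t p0 P st'"
    using while_option_rule[OF _ run, of "queue_inv sched t p0 P"] main assms by blast
  moreover have "\<not> more st'" by (rule while_option_stop[OF run])
  then obtain p S where "st' = ([], p, S)" unfolding more_def by (cases st') auto
  ultimately show ?thesis
    using run by (simp add: queue_loop_def more_def step_def)
qed

section \<open>The potential, over time and at a deadline\<close>

definition opt_count :: "real \<Rightarrow> 'v \<Rightarrow> real" where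
  "opt_count t u = real (length (filter (\<lambda>s. u \<in> fst s \<and> snd s \<le> t) opt))"

text \<open>A budget that dominates the cost so far. Each optimal service of \<open>u\<close>
  credits \<open>D * c u\<close>. The amount \<open>c u - p u\<close> was invested in
  \<open>u\<close> since its last reset, and each unit is debited \<open>D + 1 - level u\<close>, at
  most \<open>D - level v\<close> for a strict ancestor \<open>v\<close> that invested. While
  \<open>u\<close> is overdue, \<open>D * p u\<close> is held in reserve.\<close>

definition potential :: "real \<Rightarrow> ('v set \<times> real) list \<Rightarrow> ('v \<Rightarrow> real) \<Rightarrow> real" where
  "potential t sched p = (\<Sum>u\<in>V. D * c u * opt_count t u - (D + 1 - level u) * (c u - p u)
     - D * of_bool (overdue t (pend sched t) u) * p u)"

lemma opt_count_mono: "t \<le> t' \<Longrightarrow> opt_count t u \<le> opt_count t' u"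
  unfolding opt_count_def by (auto intro!: length_filter_mono)

text \<open>Services at time \<open>t\<close> itself count as past, matching the strict
  \<open>t < snd s\<close> in \<open>overdue\<close>.\<close>

lemma opt_count_less:
  assumes "s \<in> set opt" "u \<in> fst s" "t < snd s" "snd s \<le> t'"
  shows "opt_count t u + 1 \<le> opt_count t' u"
proof -
  have "length (filter (\<lambda>s. u \<in> fst s \<and> snd s \<le> t) opt) < length (filter (\<lambda>s. u \<in> fst s \<and> snd s \<le> t') opt)"
    by (rule length_filter_strict_mono[of s]) (use assms in auto)
  then show ?thesis unfolding opt_count_def by simp
qed

text \<open>A node only becomes overdue through an intermediate optimal service of it, which pays for
  the change of status.\<close>
lemma overdue_advance:
  assumes "t \<le> t'"
  shows "opt_count t u + of_bool (overdue t' (pend sched t') u)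
    \<le> opt_count t' u + of_bool (overdue t (pend sched t) u)"
proof (cases "overdue t' (pend sched t') u \<and> \<not> overdue t (pend sched t) u")
  case True
  then obtain \<gamma> where \<gamma>: "\<gamma> \<in> pend sched t'" "u \<in> anc par (rnode \<gamma>)"
    "\<not> (\<exists>s\<in>set opt. u \<in> fst s \<and> t' < snd s \<and> snd s \<le> dl \<gamma>)"
    unfolding overdue_def by blast
  \<comment> \<open>Either \<open>\<gamma>\<close> was already pending at \<open>t\<close> but did
    not make \<open>u\<close> overdue, or it arrived after \<open>t\<close> and feasibility supplies
    a later service.\<close>
  have "\<exists>s\<in>set opt. u \<in> fst s \<and> t < snd s \<and> snd s \<le> dl \<gamma>"
  proof (cases "arr \<gamma> \<le> t")
    case arrived: True
    then have "\<gamma> \<in> pend sched t" using \<gamma>(1) unfolding pend_def pending_def by blast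
    then show ?thesis using True \<gamma>(2) unfolding overdue_def by blast
  next
    case False
    obtain s where s: "s \<in> set opt" "satisfies s \<gamma>"
      using feas \<gamma>(1) pend_subset unfolding feasible_def by blast
    moreover have "u \<in> fst s"
      using s feas \<gamma>(2) rooted_subtree_anc_subset unfolding feasible_def satisfies_def by blast
    ultimately show ?thesis using False unfolding satisfies_def by force
  qed
  then obtain s where s: "s \<in> set opt" "u \<in> fst s" "t < snd s" "snd s \<le> dl \<gamma>" by blast
  then have "snd s \<le> t'" using \<gamma>(3) by force
  then show ?thesis using opt_count_less s True by simp
next
  case False
  then show ?thesis using opt_count_mono[OF assms, of u] by (auto simp: of_bool_def)
qed

lemma overdue_stays:
  assumes "t \<le> t'" "overdue t (pend sched t) u"
  shows "overdue t' (pend sched t') u"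
proof -
  have "pend sched t \<subseteq> pend sched t'" using assms(1) unfolding pend_def pending_def by auto
  then show ?thesis using assms unfolding overdue_def by (meson order.strict_trans1 subsetD)
qed

text \<open>Prices are fixed, so only the reserves and the optimal credits move. A new reserve is at
  most \<open>D * c u\<close>, and an intermediate optimal service credits that much.\<close>

lemma potential_advance:
  assumes "t \<le> t'" "price_inv p"
  shows "potential t sched p \<le> potential t' sched p"
  unfolding potential_def
proof (rule sum_mono)
  fix u assume u: "u \<in> V"
  have p: "0 < p u" "p u \<le> c u" using assms(2) u unfolding price_inv_def by auto
  let ?o = "of_bool (overdue t (pend sched t) u) :: real"
  let ?o' = "of_bool (overdue t' (pend sched t') u) :: real"
  have "?o \<le> ?o'" using overdue_stays[OF assms(1)] by simp
  then have "(?o' - ?o) * p u \<le> (?o' - ?o) * c u" using p by (intro mult_left_mono) auto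
  also have "\<dots> \<le> (opt_count t' u - opt_count t u) * c u"
    using overdue_advance[OF assms(1), of u sched] cost_pos[OF u] by (intro mult_right_mono) auto
  finally have "D * ((?o' - ?o) * p u) \<le> D * ((opt_count t' u - opt_count t u) * c u)"
    by (intro mult_left_mono) auto
  then show "D * c u * opt_count t u - (D + 1 - level u) * (c u - p u) - D * ?o * p u
    \<le> D * c u * opt_count t' u - (D + 1 - level u) * (c u - p u) - D * ?o' * p u"
    by (simp add: algebra_simps)
qed

text \<open>For a transmitted node, the coefficient in \<open>queue_inv\<close> minus its weight is
  1, less \<open>D\<close> if its overdue status ends. The queue invariant thus bounds the
  transmission cost by the weighted price drops plus the reserves released.\<close>

lemma potential_event:
  assumes ev: "wf_event par c R lin t (p, sched) = (p', sched')"
    and \<rho>: "\<rho> \<in> R" "dl \<rho> = t"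
    and expired: "\<forall>\<gamma>\<in>R. dl \<gamma> < t \<longrightarrow> (\<exists>s\<in>set sched. satisfies s \<gamma>)"
    and p: "price_inv p"
  shows "price_inv p' \<and> set sched \<subseteq> set sched' \<and> (\<exists>s\<in>set sched'. satisfies s \<rho>) \<and>
    sched_cost c sched' + potential t sched p \<le> sched_cost c sched + potential t sched' p'"
proof -
  have the: "(THE \<rho>. \<rho> \<in> R \<and> dl \<rho> = t) = \<rho>"
    using \<rho> inj_dl by (intro the_equality) (auto dest: inj_onD)
  have \<rho>V: "rnode \<rho> \<in> V" and arr\<rho>: "arr \<rho> \<le> t" using \<rho> rnode_in_V[of \<rho>] arr_le_dl[of \<rho>] by auto
  show ?thesis
  proof (cases "pending R sched t \<rho>")
    case False
    then have "p' = p" "sched' = sched" using ev by (auto simp: wf_event_def the Let_def)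
    then show ?thesis using False p \<rho> arr\<rho> unfolding pending_def by auto
  next
    case True
    define P where "P = anc par (rnode \<rho>)"
    define p0 where "p0 = (\<lambda>u. if u \<in> P then c u else p u)"
    let ?X = "pend sched t"
    let ?w = "weight t ?X"
    have P: "rooted_subtree V r par P" unfolding P_def by (rule rooted_subtree_anc[OF \<rho>V])
    then have PV: "P \<subseteq> V" unfolding rooted_subtree_def by blast
    have p0: "price_inv p0" using p cost_pos unfolding price_inv_def p0_def by auto
    have "queue_inv sched t p0 P (lin P, p0, P)"
      using P PV lin p0 unfolding queue_inv_def by (auto simp: p0_def)
    then obtain q F where q: "queue_loop par c R lin sched t (lin P, p0, P) = ([], q, F)"
      and inv: "queue_inv sched t p0 P ([], q, F)" using queue_loop_inv by blast
    have eqs: "p' = q" "sched' = sched @ [(F, t)]"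
      using ev q True by (auto simp: wf_event_def the Let_def P_def p0_def)
    have F: "P \<subseteq> F" "rooted_subtree V r par F" "\<forall>u\<in>F. p' u = c u" "price_inv p'"
      and sum: "(\<Sum>v\<in>F. c v * (level v - D + D * of_bool (overdue t {\<gamma> \<in> ?X. rnode \<gamma> \<notin> F} v)))
       \<le> (\<Sum>u\<in>V. ?w u * (p0 u - p' u)) + (\<Sum>u\<in>F - P. ?w u * c u)"
      using inv eqs unfolding queue_inv_def by auto
    have FV: "F \<subseteq> V" using F(2) unfolding rooted_subtree_def by blast
    then have finF: "finite F" using finite_V finite_subset by blast
    \<comment> \<open>No deadline before \<open>t\<close> was missed, so transmitting at
      \<open>t\<close> satisfies exactly those pending requests whose node is in
      \<open>F\<close>.\<close>
    have live: "t \<le> dl \<gamma>" if "\<gamma> \<in> ?X" for \<gamma>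
      using that expired unfolding pend_def pending_def by force
    have pend': "pend sched' t = {\<gamma> \<in> ?X. rnode \<gamma> \<notin> F}"
      using live unfolding eqs pend_def pending_def satisfies_def by auto
    let ?o = "\<lambda>u. of_bool (overdue t ?X u) :: real"
    let ?o' = "\<lambda>u. of_bool (overdue t (pend sched' t) u) :: real"
    \<comment> \<open>\<open>\<rho>\<close> expires at \<open>t\<close>, which leaves no time for a
      later optimal service, so its whole path is overdue and the weights are
      \<open>level u - 1\<close>.\<close>
    have w_nonneg: "0 \<le> ?w u" if "u \<in> P" for u
    proof -
      have "overdue t ?X u"
        unfolding overdue_def using that True \<rho> by (intro bexI[of _ \<rho>]) (auto simp: P_def pend_def)
      then show ?thesis using level_ge_1[of u] that PV unfolding weight_def by auto
    qed
    have "(\<Sum>u\<in>V. ?w u * (p0 u - p' u)) = (\<Sum>u\<in>V. ?w u * (p u - p' u)) + (\<Sum>u\<in>V. ?w u * (p0 u - p u))"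
      unfolding sum.distrib[symmetric] by (intro sum.cong) (auto simp: algebra_simps)
    also have "(\<Sum>u\<in>V. ?w u * (p0 u - p u)) = (\<Sum>u\<in>P. ?w u * (p0 u - p u))"
      using PV finite_V by (intro sum.mono_neutral_right) (auto simp: p0_def)
    \<comment> \<open>Nobody paid for the path, but with nonnegative weights its reset gains at most
      \<open>c u\<close> times the weight; this extends the sum over \<open>F - P\<close> to all of
      \<open>F\<close>.\<close>
    also have "\<dots> \<le> (\<Sum>u\<in>P. ?w u * c u)"
    proof (intro sum_mono mult_left_mono w_nonneg)
      fix u assume "u \<in> P"
      then have "0 < p u" using p PV unfolding price_inv_def by blast
      then show "p0 u - p u \<le> c u" using \<open>u \<in> P\<close> by (simp add: p0_def)
    qed
    finally have "(\<Sum>v\<in>F. c v * (level v - D + D * ?o' v))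
        \<le> (\<Sum>u\<in>V. ?w u * (p u - p' u)) + ((\<Sum>u\<in>P. ?w u * c u) + (\<Sum>u\<in>F - P. ?w u * c u))"
      using sum unfolding pend' by linarith
    also have "(\<Sum>u\<in>P. ?w u * c u) + (\<Sum>u\<in>F - P. ?w u * c u) = (\<Sum>u\<in>F. ?w u * c u)"
      using sum.subset_diff[OF F(1) finF, of "\<lambda>u. ?w u * c u"] by simp
    finally have "(\<Sum>v\<in>F. c v * (level v - D + D * ?o' v)) - (\<Sum>u\<in>F. ?w u * c u)
        \<le> (\<Sum>u\<in>V. ?w u * (p u - p' u))" by simp
    moreover have "(\<Sum>v\<in>F. c v * (level v - D + D * ?o' v)) - (\<Sum>u\<in>F. ?w u * c u) =
        sum c F - (\<Sum>u\<in>F. D * (?o u - ?o' u) * p' u)"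
      unfolding sum_subtractf[symmetric]
      by (intro sum.cong) (use F(3) in \<open>auto simp: weight_def algebra_simps\<close>)
    moreover have "(\<Sum>u\<in>F. D * (?o u - ?o' u) * p' u) \<le> (\<Sum>u\<in>V. D * (?o u - ?o' u) * p' u)"
    proof (rule sum_mono2[OF finite_V FV])
      fix u assume "u \<in> V - F"
      then have "0 < p' u" using F(4) unfolding price_inv_def by blast
      moreover have "?o' u \<le> ?o u"
        unfolding pend' using overdue_mono[of t _ u ?X] by auto
      ultimately show "0 \<le> D * (?o u - ?o' u) * p' u" by simp
    qed
    moreover have "potential t sched' p' - potential t sched p =
        (\<Sum>u\<in>V. ?w u * (p u - p' u)) + (\<Sum>u\<in>V. D * (?o u - ?o' u) * p' u)"
      unfolding potential_def sum_subtractf[symmetric] sum.distrib[symmetric]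
      by (intro sum.cong) (auto simp: weight_def algebra_simps)
    moreover have "sched_cost c sched' = sched_cost c sched + sum c F"
      by (simp add: eqs sched_cost_def)
    moreover have "satisfies (F, t) \<rho>"
      using F(1) arr\<rho> \<rho> unfolding satisfies_def P_def by auto
    ultimately show ?thesis using F(4) by (auto simp: eqs)
  qed
qed

section \<open>The whole run and the competitive ratio\<close>

lemma potential_run:
  assumes "fold (wf_event par c R lin) ts (p, sched) = (p', sched')"
    and "sorted ts" "set ts \<subseteq> dl ` R" "\<forall>x\<in>set ts. t \<le> x"
    and "\<forall>\<gamma>\<in>R. dl \<gamma> \<in> set ts \<or> (\<exists>s\<in>set sched. satisfies s \<gamma>)"
    and "price_inv p" "sched_cost c sched \<le> potential t sched p"
  shows "\<exists>t'. price_inv p' \<and> (\<forall>\<gamma>\<in>R. \<exists>s\<in>set sched'. satisfies s \<gamma>) \<and>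
    sched_cost c sched' \<le> potential t' sched' p'"
  using assms
proof (induction ts arbitrary: p sched t)
  case Nil
  then show ?case by auto
next
  case (Cons x ts)
  obtain q sch where ev: "wf_event par c R lin x (p, sched) = (q, sch)"
    by (cases "wf_event par c R lin x (p, sched)")
  obtain \<rho> where \<rho>: "\<rho> \<in> R" "dl \<rho> = x" using Cons.prems(3) by auto
  \<comment> \<open>By sortedness a deadline before \<open>x\<close> is no longer on the list, so
    its request has been served.\<close>
  have expired: "\<forall>\<gamma>\<in>R. dl \<gamma> < x \<longrightarrow> (\<exists>s\<in>set sched. satisfies s \<gamma>)"
    using Cons.prems(2,5) by force
  note post = potential_event[OF ev \<rho> expired Cons.prems(6)]
  have "potential t sched p \<le> potential x sched p"
    by (rule potential_advance) (use Cons.prems in auto)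
  then have cost: "sched_cost c sch \<le> potential x sch q" using post Cons.prems(7) by linarith
  have served: "\<forall>\<gamma>\<in>R. dl \<gamma> \<in> set ts \<or> (\<exists>s\<in>set sch. satisfies s \<gamma>)"
  proof
    fix \<gamma> assume "\<gamma> \<in> R"
    show "dl \<gamma> \<in> set ts \<or> (\<exists>s\<in>set sch. satisfies s \<gamma>)"
    proof (cases "dl \<gamma> = x")
      case True
      then have "\<gamma> = \<rho>" using \<rho> \<open>\<gamma> \<in> R\<close> inj_dl by (auto dest: inj_onD)
      then show ?thesis using post by blast
    next
      case False
      then show ?thesis using Cons.prems(5) \<open>\<gamma> \<in> R\<close> post by fastforce
    qed
  qed
  show ?case
    by (rule Cons.IH[of q sch x]) (use Cons.prems ev served cost post in auto)
qed

theorem waterfall_competitive: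
  "sched_cost c (waterfall par c R lin) \<le> D * sched_cost c opt"
proof -
  let ?ts = "sorted_list_of_set (dl ` R)"
  obtain p' sched' where run: "fold (wf_event par c R lin) ?ts (c, []) = (p', sched')"
    by (cases "fold (wf_event par c R lin) ?ts (c, [])")
  \<comment> \<open>A time before every arrival, when nothing is pending; the inserted
    \<open>0\<close> keeps \<open>Min\<close> meaningful for empty \<open>R\<close>.\<close>
  define t0 where "t0 = Min (insert 0 (arr ` R)) - 1"
  have early: "t0 < arr \<gamma>" if "\<gamma> \<in> R" for \<gamma>
  proof -
    have "Min (insert 0 (arr ` R)) \<le> arr \<gamma>" using that finite_R by (intro Min_le) auto
    then show ?thesis unfolding t0_def by simp
  qed
  have "pend [] t0 = {}" using early unfolding pend_def pending_def by force
  then have "0 \<le> potential t0 [] c"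
    unfolding potential_def overdue_def opt_count_def
    using cost_pos by (auto intro!: sum_nonneg simp: less_imp_le)
  moreover have "price_inv c" using cost_pos unfolding price_inv_def by auto
  moreover have "\<forall>x\<in>set ?ts. t0 \<le> x" using early arr_le_dl finite_R by force
  ultimately obtain t where p': "price_inv p'"
    and served: "\<forall>\<gamma>\<in>R. \<exists>s\<in>set sched'. satisfies s \<gamma>"
    and cost: "sched_cost c sched' \<le> potential t sched' p'"
    using potential_run[OF run, of t0] finite_R by (auto simp: sched_cost_def)
  \<comment> \<open>Nothing is pending at the end, so no reserve remains; the investment debits are
    nonnegative, and only the optimal credits bound the cost.\<close>
  have "pend sched' t = {}" using served unfolding pend_def pending_def by blast
  then have "potential t sched' p' =
      (\<Sum>u\<in>V. D * c u * opt_count t u - (D + 1 - level u) * (c u - p' u))"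
    unfolding potential_def overdue_def by simp
  also have "\<dots> \<le> (\<Sum>u\<in>V. D * (c u * real (length (filter (\<lambda>s. u \<in> fst s) opt))))"
  proof (rule sum_mono)
    fix u assume u: "u \<in> V"
    have "0 \<le> (D + 1 - level u) * (c u - p' u)"
      using level_le_depth[OF u] p' u unfolding price_inv_def by (intro mult_nonneg_nonneg) auto
    moreover have "length (filter (\<lambda>s. u \<in> fst s \<and> snd s \<le> t) opt) \<le> length (filter (\<lambda>s. u \<in> fst s) opt)"
      by (rule length_filter_mono) auto
    then have "D * c u * opt_count t u \<le> D * c u * real (length (filter (\<lambda>s. u \<in> fst s) opt))"
      unfolding opt_count_def using cost_pos[OF u] by (intro mult_left_mono) auto
    ultimately show "D * c u * opt_count t u - (D + 1 - level u) * (c u - p' u)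
      \<le> D * (c u * real (length (filter (\<lambda>s. u \<in> fst s) opt)))" by (simp add: mult.assoc)
  qed
  also have "\<dots> = D * sched_cost c opt"
    using sched_cost_by_node[OF finite_V, of opt c] feas
    unfolding feasible_def rooted_subtree_def by (simp add: sum_distrib_left)
  finally show ?thesis using cost run by (simp add: waterfall_def)
qed

end

theorem mainTheorem6:
  fixes V :: "'v set" and r :: 'v and par :: "'v \<Rightarrow> 'v" and c :: "'v \<Rightarrow> real"
    and R :: "'v req set" and lin :: "'v set \<Rightarrow> 'v list"
    and sched :: "('v set \<times> real) list"
  assumes inst: "mlapd_instance V r par c R"
    and lin: "\<forall>X. X \<subseteq> V \<longrightarrow> distinct (lin X) \<and> set (lin X) = X"
    and feas: "feasible V r par R sched"
  shows "sched_cost c (waterfall par c R lin) \<le> real (depth V par) * sched_cost c sched"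
proof -
  interpret waterfall_run V r par c R lin sched
    by unfold_locales (fact inst lin feas)+
  show ?thesis by (rule waterfall_competitive)
qed

end
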